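(* Consider the F-RAN system described in the context, with $n_T$ antennas at each EN. For any fractional cache size $\mu\in[0,1]$ and fronthaul rate $r\ge 0$, $$\frac{\delta_{ach}(\mu,r)}{\delta^*(\mu,r)}\le\frac32,$$ where $\delta^*(\mu,r)$ is the minimum NDT under serial fronthaul-edge transmission and $\delta_{ach}(\mu,r)$ is the achievable NDT defined in the context.
   Context: F-RAN model. $K_T,K_R,n_T\ge 1$ and $N\ge K_R$ are integers; $[K]=\{1,\dots,K\}$. There are $K_T$ edge nodes (ENs) with $n_T$ antennas each, $K_R$ single-antenna users, and a cloud with a library of $N$ files $W_1,\dots,W_N$ of equal size. Each file is split into $F\ge 1$ equal packets, $\mathcal W_n=\{W_{n1},\dots,W_{nF}\}$ ($F$ is a free design parameter). $\mu\in[0,1]$ is the fractional cache size and $r\ge 0$ the fronthaul rate (each fronthaul link has capacity $r\log P$ bits per channel use, $P$ = SNR). Caching: EN $i$ stores sets $\mathcal C_{in}\subseteq\mathcal W_n$ with $|\mathcal C_{in}|\le \mu F$ for every $n$, chosen before the requests are known; $\mathcal C_i=\bigcup_n\mathcal C_{in}$. Delivery: user $k$ requests file $d_k\in[N]$; $\boldsymbol d=(d_1,\dots,d_{K_R})$. The cloud sends to EN $i$ a set $\mathcal F_i$ of (uncoded) packets of requested files. Then edge transmission takes place in $B$ blocks by one-shot linear precoding: in each block $b$ a set $\mathcal R(b)\subseteq[K_R]$ of users is served, each $k\in\mathcal R(b)$ with exactly one packet of $W_{d_k}$; the stream for user $k$ is sent with precoding vectors $\boldsymbol v_{i,k}\in\mathbb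 C^{n_T}$ by those ENs $i$ whose set $\mathcal C_i\cup\mathcal F_i$ contains that packet (the other ENs use $\boldsymbol v_{i,k}=0$); decodability without interference means $\sum_i \boldsymbol h_{ki}^T\boldsymbol v_{i,k}\ne 0$ and $\sum_i \boldsymbol h_{k'i}^T\boldsymbol v_{i,k}=0$ for all $k'\in\mathcal R(b)\setminus\{k\}$, where $\boldsymbol h_{ki}=\boldsymbol h_{ki}(b)\in\mathbb C^{n_T}$ is the channel from EN $i$ to user $k$. After the $B$ blocks every user must have received all $F$ packets of its file. The fronthaul sets and the edge transmission may depend on $\boldsymbol d$ and on the channels. The channels are arbitrary but non-degenerate: in each block, every square submatrix of the $K_R\times K_Tn_T$ matrix with rows $(\boldsymbol h_{k1}^T,\dots,\boldsymbol h_{kK_T}^T)$ is invertible. NDT (serial mode): for a policy and request $\boldsymbol d$, the fronthaul NDT is $\max_i|\mathcal F_i|/(Fr)$ (if $r=0$, nothing may be sent on the fronthaul and this is $0$), the edge NDT is $B/F$, and the NDT of the policy is the maximum over $\boldsymbol d$ of their sum. $\bar\delta(\mu,r)$ is the infimum of the NDT over all $F\ge1$ and all policies ($+\infty$ if there is none), and the minimum NDT $\delta^*(\mu,r)$ is the lower convex envelope of $\bar\delta(\mu,r)$ as a function of $\mu\in[0,1]$ for fixed $r$. Achievable NDT: with $(x)^+=\max\{x,0\}$, $m_{max}=\min\{K_T,\lceil K_R/n_T\rceil\}$, $r_{th}=\frac{n_T}{K_T}m_{max}^2$, $m(r)=[\sqrt{K_Tr/n_T}]$ (nearest positive integer, ties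 broken by any fixed rule) if $r<r_{th}$ and $m(r)=m_{max}$ if $r\ge r_{th}$, let $m(\mu,r)=m(r)$ if $\mu K_T<m(r)$, $m(\mu,r)=\lfloor\mu K_T\rfloor$ if $m(r)\le\mu K_T\le m_{max}$, and $m(\mu,r)=m_{max}$ if $\mu K_T>m_{max}$. Then $\delta_{ach}(\mu,r)$ is the lower convex envelope, as a function of $\mu\in[0,1]$ for fixed $r$, of $$\frac{K_R\,(m(\mu,r)-\lfloor\mu K_T\rfloor)^+}{K_Tr}+\frac{K_R}{\min\{m(\mu,r)n_T,K_R\}}.$$ For $r=0$, a quotient with denominator $K_Tr$ is $+\infty$ if its numerator is positive and $0$ if its numerator is $0$; when $\delta^*(\mu,r)=+\infty$ the claim is void. *)

theory Defs
  imports
    "HOL-Analysis.Convex"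
    "HOL-Library.Extended_Real"
    "HOL-Library.FuncSet"
    "Jordan_Normal_Form.DL_Submatrix"
begin

text \<open>
  Packet \<open>f\<close> of file \<open>n\<close> is the pair \<open>(n, f)\<close>.  Users, edge nodes, files, packets of a file,
  antennas and transmission blocks are numbered from 0.
\<close>

type_synonym packet = "nat \<times> nat"

definition file_packets :: "nat \<Rightarrow> nat \<Rightarrow> packet set" where
  "file_packets F n = {n} \<times> {..<F}"

text \<open>
  Argument order: \<open>fronthaul i\<close>, \<open>served b\<close>, \<open>sent b k\<close>, \<open>precoder b i k\<close> and \<open>cached i n\<close>, for
  edge node \<open>i\<close>, block \<open>b\<close>, user \<open>k\<close> and file \<open>n\<close>.  The caches do not depend on the request
  vector, which is the argument of \<open>deliver\<close>.
\<close>

record delivery =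
  fronthaul :: "nat \<Rightarrow> packet set"
  num_blocks :: nat
  served :: "nat \<Rightarrow> nat set"
  sent :: "nat \<Rightarrow> nat \<Rightarrow> packet"
  precoder :: "nat \<Rightarrow> nat \<Rightarrow> nat \<Rightarrow> complex vec"

record policy =
  num_packets :: nat
  cached :: "nat \<Rightarrow> nat \<Rightarrow> packet set"
  deliver :: "(nat \<Rightarrow> nat) \<Rightarrow> delivery"

text \<open>
  The library predicate \<open>convex_on\<close> is for real-valued functions only.  The values here may be
  infinite; in type \<open>ereal\<close> we have \<open>0 * \<infinity> = 0\<close> and \<open>\<infinity> + (-\<infinity>) = \<infinity>\<close>.  The lower convex
  envelope is the pointwise largest convex minorant.
\<close>

definition ereal_convex_on :: "real set \<Rightarrow> (real \<Rightarrow> ereal) \<Rightarrow> bool" where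
  "ereal_convex_on S g \<longleftrightarrow> convex S \<and>
     (\<forall>x\<in>S. \<forall>y\<in>S. \<forall>t\<in>{0..1}.
        g ((1 - t) * x + t * y) \<le> ereal (1 - t) * g x + ereal t * g y)"

definition lower_convex_envelope :: "real set \<Rightarrow> (real \<Rightarrow> ereal) \<Rightarrow> real \<Rightarrow> ereal" where
  "lower_convex_envelope S f x =
     (SUP g\<in>{g. ereal_convex_on S g \<and> (\<forall>y\<in>S. g y \<le> f y)}. g x)"

text \<open>
  \<open>H b\<close> is the channel matrix of block \<open>b\<close>: row \<open>k\<close> belongs to user \<open>k\<close>, and column
  \<open>i * nT + a\<close> to antenna \<open>a\<close> of edge node \<open>i\<close>.  The channels are fixed, so every part of a
  policy may depend on them.
\<close>

locale fran =
  fixes KT KR nT N :: nat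
    and H :: "nat \<Rightarrow> complex mat"
  assumes KT_pos: "KT \<ge> 1" and KR_pos: "KR \<ge> 1" and nT_pos: "nT \<ge> 1"
    and N_ge_KR: "N \<ge> KR"
    and H_carrier: "\<And>b. H b \<in> carrier_mat KR (KT * nT)"
    and H_nondegenerate:
      "\<And>b I J. I \<subseteq> {..<KR} \<Longrightarrow> J \<subseteq> {..<KT * nT} \<Longrightarrow> card I = card J \<Longrightarrow>
         invertible_mat (submatrix (H b) I J)"
begin

definition channel :: "nat \<Rightarrow> nat \<Rightarrow> nat \<Rightarrow> complex vec" where
  "channel b k i = vec nT (\<lambda>a. H b $$ (k, i * nT + a))"

definition requests :: "(nat \<Rightarrow> nat) set" where
  "requests = {..<KR} \<rightarrow>\<^sub>E {..<N}"

definition valid_caching :: "real \<Rightarrow> nat \<Rightarrow> (nat \<Rightarrow> nat \<Rightarrow> packet set) \<Rightarrow> bool" where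
  "valid_caching \<mu> F C \<longleftrightarrow>
     (\<forall>i<KT. \<forall>n<N. C i n \<subseteq> file_packets F n \<and> real (card (C i n)) \<le> \<mu> * real F)"

definition available :: "(nat \<Rightarrow> nat \<Rightarrow> packet set) \<Rightarrow> delivery \<Rightarrow> nat \<Rightarrow> packet set" where
  "available C D i = (\<Union>n<N. C i n) \<union> fronthaul D i"

definition valid_fronthaul :: "real \<Rightarrow> nat \<Rightarrow> (nat \<Rightarrow> nat) \<Rightarrow> delivery \<Rightarrow> bool" where
  "valid_fronthaul r F d D \<longleftrightarrow>
     (\<forall>i<KT. fronthaul D i \<subseteq> (\<Union>k<KR. file_packets F (d k)) \<and> (r = 0 \<longrightarrow> fronthaul D i = {}))"

definition valid_edge ::
    "nat \<Rightarrow> (nat \<Rightarrow> nat \<Rightarrow> packet set) \<Rightarrow> (nat \<Rightarrow> nat) \<Rightarrow> delivery \<Rightarrow> bool" where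
  "valid_edge F C d D \<longleftrightarrow>
     (\<forall>b<num_blocks D. served D b \<subseteq> {..<KR} \<and>
        (\<forall>k\<in>served D b.
           sent D b k \<in> file_packets F (d k) \<and>
           (\<forall>i<KT. precoder D b i k \<in> carrier_vec nT \<and>
              (sent D b k \<notin> available C D i \<longrightarrow> precoder D b i k = 0\<^sub>v nT)) \<and>
           (\<Sum>i<KT. channel b k i \<bullet> precoder D b i k) \<noteq> 0 \<and>
           (\<forall>k'\<in>served D b - {k}. (\<Sum>i<KT. channel b k' i \<bullet> precoder D b i k) = 0)))"

definition complete_delivery :: "nat \<Rightarrow> (nat \<Rightarrow> nat) \<Rightarrow> delivery \<Rightarrow> bool" where
  "complete_delivery F d D \<longleftrightarrow>
     (\<forall>k<KR. file_packets F (d k) \<subseteq> {sent D b k | b. b < num_blocks D \<and> k \<in> served D b})"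

definition valid_policy :: "real \<Rightarrow> real \<Rightarrow> policy \<Rightarrow> bool" where
  "valid_policy \<mu> r p \<longleftrightarrow>
     num_packets p \<ge> 1 \<and>
     valid_caching \<mu> (num_packets p) (cached p) \<and>
     (\<forall>d\<in>requests.
        valid_fronthaul r (num_packets p) d (deliver p d) \<and>
        valid_edge (num_packets p) (cached p) d (deliver p d) \<and>
        complete_delivery (num_packets p) d (deliver p d))"

definition fronthaul_NDT :: "real \<Rightarrow> nat \<Rightarrow> delivery \<Rightarrow> real" where
  "fronthaul_NDT r F D =
     (if r = 0 then 0 else (MAX i\<in>{..<KT}. real (card (fronthaul D i))) / (real F * r))"

definition edge_NDT :: "nat \<Rightarrow> delivery \<Rightarrow> real" where
  "edge_NDT F D = real (num_blocks D) / real F"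

definition policy_NDT :: "real \<Rightarrow> policy \<Rightarrow> real" where
  "policy_NDT r p =
     (MAX d\<in>requests. fronthaul_NDT r (num_packets p) (deliver p d)
                     + edge_NDT (num_packets p) (deliver p d))"

definition infimum_NDT :: "real \<Rightarrow> real \<Rightarrow> ereal" where
  "infimum_NDT \<mu> r = (INF p\<in>{p. valid_policy \<mu> r p}. ereal (policy_NDT r p))"

definition minimum_NDT :: "real \<Rightarrow> real \<Rightarrow> ereal" where
  "minimum_NDT \<mu> r = lower_convex_envelope {0..1} (\<lambda>\<mu>'. infimum_NDT \<mu>' r) \<mu>"

definition m_max :: nat where
  "m_max = min KT (nat \<lceil>real KR / real nT\<rceil>)"

definition r_th :: real where
  "r_th = real nT / real KT * (real m_max)\<^sup>2"

text \<open>
  In what follows \<open>near\<close> is the rounding to the nearest positive integer, with its rule for ties.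
\<close>

definition m_rate :: "(real \<Rightarrow> nat) \<Rightarrow> real \<Rightarrow> nat" where
  "m_rate near r = (if r < r_th then near (sqrt (real KT * r / real nT)) else m_max)"

definition multiplicity_m :: "(real \<Rightarrow> nat) \<Rightarrow> real \<Rightarrow> real \<Rightarrow> nat" where
  "multiplicity_m near \<mu> r =
     (if \<mu> * real KT < real (m_rate near r) then m_rate near r
      else if \<mu> * real KT \<le> real m_max then nat \<lfloor>\<mu> * real KT\<rfloor>
      else m_max)"

text \<open>
  For \<open>r = 0\<close> the first quotient is \<open>\<infinity>\<close> if its numerator is positive and \<open>0\<close> if its numerator
  is \<open>0\<close>, by the definition of division on \<open>ereal\<close>.
\<close>

definition scheme_NDT :: "(real \<Rightarrow> nat) \<Rightarrow> real \<Rightarrow> real \<Rightarrow> ereal" where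
  "scheme_NDT near \<mu> r =
     ereal (real KR * max (real (multiplicity_m near \<mu> r) - of_int \<lfloor>\<mu> * real KT\<rfloor>) 0)
       / ereal (real KT * r)
     + ereal (real KR / real (min (multiplicity_m near \<mu> r * nT) KR))"

definition achievable_NDT :: "(real \<Rightarrow> nat) \<Rightarrow> real \<Rightarrow> real \<Rightarrow> ereal" where
  "achievable_NDT near \<mu> r = lower_convex_envelope {0..1} (\<lambda>\<mu>'. scheme_NDT near \<mu>' r) \<mu>"

end

definition nearest_positive_rounding :: "(real \<Rightarrow> nat) \<Rightarrow> bool" where
  "nearest_positive_rounding near \<longleftrightarrow>
     (\<forall>x. is_arg_min (\<lambda>j. \<bar>x - real j\<bar>) (\<lambda>j. j \<ge> 1) (near x))"

end

theory Submission
  imports Defs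
begin

text \<open>
  A packet held by \<open>m\<close> edge nodes is steered by \<open>m * nT\<close> antennas.  Since the channel is
  non-degenerate, it can be nulled at fewer than \<open>m * nT\<close> other users, so it is delivered in a
  block with at most \<open>min (m * nT) KR\<close> users and takes up at least the reciprocal share of that
  block.  If \<open>c\<close> of the \<open>m\<close> copies were cached, the fronthaul carries the other \<open>m - c\<close>.  For
  pairwise distinct requests, the NDT of a policy is therefore at least the sum, over all requested
  packets, of \<open>((m - c) / (KT * r) + 1 / min (m * nT) KR) / F\<close>.

  For integers \<open>c \<le> m\<close>, the value of the scheme at cache size \<open>c / KT\<close> is at most \<open>3 / 2 * KR\<close>
  times the summand in parentheses.  Averaging over the packets with Jensen's inequality shows
  that every convex minorant of the scheme is at most \<open>3 / 2\<close> times the NDT of every policy, so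
  \<open>2 / 3\<close> of the achievable NDT is a convex minorant of the infimum NDT.
\<close>

section \<open>Zero forcing\<close>

lemma bij_betw_pick: "finite J \<Longrightarrow> bij_betw (pick J) {..<card J} J"
proof -
  assume fin: "finite J"
  have inj: "inj_on (pick J) {..<card J}"
    by (rule inj_onI) (metis lessThan_iff nat_neq_iff pick_mono_le)
  moreover have "pick J ` {..<card J} \<subseteq> J"
    using pick_in_set_le by auto
  ultimately show ?thesis
    by (simp add: bij_betw_def card_image card_subset_eq fin)
qed

text \<open>Reindexing through \<open>pick\<close> turns the vanishing sums into
  \<open>S *\<^sub>v w = 0\<close>, where \<open>w\<close> lists the entries of \<open>V\<close> on
  \<open>J\<close>; a left inverse of \<open>S\<close> then gives \<open>w = 0\<close>.\<close>

lemma invertible_submatrix_kernel: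
  fixes A :: "'a :: comm_ring_1 mat"
  assumes A: "A \<in> carrier_mat m n"
    and I: "I \<subseteq> {..<m}" and J: "J \<subseteq> {..<n}" and card: "card I = card J"
    and inv: "invertible_mat (submatrix A I J)"
    and zero: "\<And>k. k \<in> I \<Longrightarrow> (\<Sum>c\<in>J. A $$ (k, c) * V c) = 0"
    and c: "c \<in> J"
  shows "V c = 0"
proof -
  define q where "q = card J"
  have finJ: "finite J" using J finite_subset by blast
  have dims: "card {i. i < dim_row A \<and> i \<in> I} = q" "card {j. j < dim_col A \<and> j \<in> J} = q"
  proof -
    have "{i. i < dim_row A \<and> i \<in> I} = I" "{j. j < dim_col A \<and> j \<in> J} = J"
      using A I J by auto
    then show "card {i. i < dim_row A \<and> i \<in> I} = q" "card {j. j < dim_col A \<and> j \<in> J} = q"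
      using card by (simp_all add: q_def)
  qed
  define S where "S = submatrix A I J"
  have S: "S \<in> carrier_mat q q"
    unfolding S_def by (rule carrier_matI) (simp_all only: dim_submatrix dims)
  have S_index: "S $$ (i, j) = A $$ (pick I i, pick J j)" if "i < q" "j < q" for i j
    unfolding S_def by (rule submatrix_index) (use that dims in auto)
  obtain B where "inverts_mat S B" and BS: "inverts_mat B S"
    using inv unfolding invertible_mat_def S_def by blast
  have BS1: "B * S = 1\<^sub>m q" and B: "B \<in> carrier_mat q q"
  proof -
    \<comment> \<open>The shape of \<open>B\<close> is not part of \<open>inverts_mat\<close>; it is
      read off by comparing dimensions in both inverse equations.\<close>
    note BS' = BS[unfolded inverts_mat_def] and SB = \<open>inverts_mat S B\<close>[unfolded inverts_mat_def]
    show "B \<in> carrier_mat q q"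
    proof (rule carrier_matI)
      show "dim_row B = q" using arg_cong[OF BS', of dim_col] S by simp
      show "dim_col B = q" using arg_cong[OF SB, of dim_col] S by simp
    qed
    then show "B * S = 1\<^sub>m q" using BS' by simp
  qed
  define w where "w = vec q (\<lambda>j. V (pick J j))"
  have w: "w \<in> carrier_vec q" by (simp add: w_def)
  have "S *\<^sub>v w = 0\<^sub>v q"
  proof (rule eq_vecI)
    fix i assume "i < dim_vec (0\<^sub>v q :: 'a vec)"
    then have i: "i < q" by simp
    have "(S *\<^sub>v w) $ i = (\<Sum>j\<in>{0..<q}. A $$ (pick I i, pick J j) * V (pick J j))"
      using i S by (auto simp: scalar_prod_def w_def S_index intro!: sum.cong)
    also have "\<dots> = (\<Sum>c\<in>J. A $$ (pick I i, c) * V c)"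
      using sum.reindex_bij_betw[OF bij_betw_pick[OF finJ], of "\<lambda>c. A $$ (pick I i, c) * V c"]
      by (simp add: q_def lessThan_atLeast0)
    also have "\<dots> = 0"
      by (rule zero) (use i card pick_in_set_le in \<open>auto simp: q_def\<close>)
    finally show "(S *\<^sub>v w) $ i = 0\<^sub>v q $ i" using i by simp
  qed (use S in auto)
  then have "B *\<^sub>v (S *\<^sub>v w) = 0\<^sub>v q"
    using B by (intro eq_vecI) auto
  then have "w = 0\<^sub>v q"
    using assoc_mult_mat_vec[OF B S w] BS1 w by simp
  moreover have "c \<in> pick J ` {..<q}"
    using bij_betw_imp_surj_on[OF bij_betw_pick[OF finJ]] c by (simp add: q_def)
  then obtain j where "j < q" "c = pick J j" by blast
  ultimately show ?thesis
    using index_vec[of j q "\<lambda>j. V (pick J j)"] by (simp add: w_def)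
qed

context fran
begin

text \<open>Otherwise there are \<open>card M * nT\<close> undesired users, as many as active
  antennas. Nulling at all of them puts the precoding coefficients into the kernel of an invertible
  square submatrix, so they vanish, and so does the useful signal.\<close>

lemma zero_forcing_bound:
  assumes R: "R \<subseteq> {..<KR}" and k: "k \<in> R" and M: "M \<subseteq> {..<KT}"
    and v: "\<And>i. i < KT \<Longrightarrow> v i \<in> carrier_vec nT"
    and v0: "\<And>i. i < KT \<Longrightarrow> i \<notin> M \<Longrightarrow> v i = 0\<^sub>v nT"
    and signal: "(\<Sum>i<KT. channel b k i \<bullet> v i) \<noteq> 0"
    and interference: "\<And>k'. k' \<in> R - {k} \<Longrightarrow> (\<Sum>i<KT. channel b k' i \<bullet> v i) = 0"
  shows "card R \<le> card M * nT"
proof (rule ccontr)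
  assume "\<not> card R \<le> card M * nT"
  moreover have finR: "finite R" using R finite_subset by blast
  ultimately have "card M * nT \<le> card (R - {k})" using k by simp
  then obtain I where I: "I \<subseteq> R - {k}" "card I = card M * nT"
    by (metis obtain_subset_with_card_n)
  \<comment> \<open>\<open>V\<close> stacks the precoding vectors in the column order of
    \<open>H b\<close>, and \<open>J\<close> collects the columns of the edge nodes in
    \<open>M\<close>.\<close>
  define V where "V c = v (c div nT) $ (c mod nT)" for c
  define J where "J = {c \<in> {..<KT * nT}. c div nT \<in> M}"
  have V0: "V c = 0" if "c \<in> {..<KT * nT} - J" for c
  proof -
    have "c div nT < KT" using that by (simp add: less_mult_imp_div_less)
    moreover have "c mod nT < nT" using nT_pos by simp
    ultimately show ?thesis using that v0[of "c div nT"] by (simp add: V_def J_def)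
  qed
  have sum_J: "(\<Sum>i<KT. channel b l i \<bullet> v i) = (\<Sum>c\<in>J. H b $$ (l, c) * V c)" for l
  proof -
    have "channel b l i \<bullet> v i = (\<Sum>c\<in>{i * nT..<i * nT + nT}. H b $$ (l, c) * V c)" if "i < KT" for i
    proof -
      have "channel b l i \<bullet> v i = (\<Sum>a\<in>{0..<nT}. H b $$ (l, i * nT + a) * v i $ a)"
        using v[OF that] by (auto simp: scalar_prod_def channel_def intro!: sum.cong)
      also have "\<dots> = (\<Sum>a\<in>{0..<nT}. H b $$ (l, a + i * nT) * V (a + i * nT))"
        by (intro sum.cong) (auto simp: V_def add.commute)
      also have "\<dots> = (\<Sum>c\<in>{0 + i * nT..<nT + i * nT}. H b $$ (l, c) * V c)"
        by (rule sum.shift_bounds_nat_ivl[symmetric])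
      finally show ?thesis by (simp add: add.commute)
    qed
    then have "(\<Sum>i<KT. channel b l i \<bullet> v i) = (\<Sum>c<KT * nT. H b $$ (l, c) * V c)"
      by (simp add: sum.nat_group)
    also have "\<dots> = (\<Sum>c\<in>J. H b $$ (l, c) * V c)"
      by (rule sum.mono_neutral_right) (auto simp: J_def V0)
    finally show ?thesis .
  qed
  have card_J: "card J = card M * nT"
  proof -
    have "bij_betw (\<lambda>c. (c div nT, c mod nT)) J (M \<times> {..<nT})"
    proof (rule bij_betwI[where g = "\<lambda>(i, a). i * nT + a"])
      show "(\<lambda>(i, a). i * nT + a) \<in> M \<times> {..<nT} \<rightarrow> J"
      proof safe
        fix i a assume "i \<in> M" "a < nT"
        then have "i * nT + a < Suc i * nT" by simp
        also have "\<dots> \<le> KT * nT"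
          using M \<open>i \<in> M\<close> by (intro mult_le_mono1) (auto simp: Suc_le_eq)
        finally show "i * nT + a \<in> J" using \<open>i \<in> M\<close> \<open>a < nT\<close> by (simp add: J_def)
      qed
    qed (use nT_pos in \<open>auto simp: J_def\<close>)
    then show ?thesis by (simp add: bij_betw_same_card card_cartesian_product)
  qed
  have "V c = 0" if "c \<in> J" for c
  proof (rule invertible_submatrix_kernel[OF H_carrier[of b], of I J])
    show "invertible_mat (submatrix (H b) I J)"
      by (rule H_nondegenerate) (use I R card_J in \<open>auto simp: J_def\<close>)
    show "(\<Sum>c\<in>J. H b $$ (l, c) * V c) = 0" if "l \<in> I" for l
      using interference[of l] sum_J[of l] that I by auto
  qed (use I R card_J that in \<open>auto simp: J_def\<close>)
  then show False using signal sum_J[of k] by simp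
qed

end

section \<open>The scheme at integer cache multiplicities\<close>

lemma nearest_positive_rounding_ge_1: "nearest_positive_rounding near \<Longrightarrow> near x \<ge> 1"
  by (simp add: nearest_positive_rounding_def is_arg_min_linorder)

lemma nearest_positive_rounding_upper:
  assumes "nearest_positive_rounding near"
  shows "x \<le> real (near x) + 1 / 2"
proof -
  have "\<bar>x - real (near x)\<bar> \<le> \<bar>x - real (near x + 1)\<bar>"
    using assms unfolding nearest_positive_rounding_def is_arg_min_linorder by (metis le_add2)
  then show ?thesis by (auto simp: abs_if split: if_splits)
qed

text \<open>The competitor \<open>near x - 1\<close> is admissible only if it is positive; for small
  \<open>x\<close> the value 1 may exceed \<open>x\<close> by more than 1/2.\<close>

lemma nearest_positive_rounding_lower:
  assumes "nearest_positive_rounding near" "near x \<ge> 2"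
  shows "real (near x) - 1 / 2 \<le> x"
proof -
  have "near x - 1 \<ge> 1" using assms(2) by simp
  then have "\<bar>x - real (near x)\<bar> \<le> \<bar>x - real (near x - 1)\<bar>"
    using assms unfolding nearest_positive_rounding_def is_arg_min_linorder by blast
  then show ?thesis using assms(2) by (auto simp: abs_if of_nat_diff split: if_splits)
qed

context fran
begin

text \<open>The least share of a block that a packet held by \<open>m\<close> edge nodes can take.
  For \<open>m = 0\<close> the quotient is 0 by convention, so bounds on it are stated for
  \<open>m >= 1\<close>.\<close>

definition edge_time :: "nat \<Rightarrow> real" where
  "edge_time m = 1 / real (min (m * nT) KR)"

lemma edge_time_eq_max: "m \<ge> 1 \<Longrightarrow> edge_time m = max (1 / (real m * real nT)) (1 / real KR)"
  using KR_pos nT_pos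
  by (auto simp: edge_time_def min_def max_def field_simps simp flip: of_nat_mult)

lemma edge_time_antimono: "1 \<le> m \<Longrightarrow> m \<le> m' \<Longrightarrow> edge_time m' \<le> edge_time m"
proof -
  assume m: "1 \<le> m" "m \<le> m'"
  then have "min (m * nT) KR \<le> min (m' * nT) KR"
    by (intro min.mono mult_le_mono1) auto
  then show ?thesis
    using m KR_pos nT_pos unfolding edge_time_def
    by (intro divide_left_mono mult_pos_pos) (simp_all del: of_nat_min)
qed

lemma m_max_ge_1: "m_max \<ge> 1"
  using KT_pos KR_pos nT_pos by (auto simp: m_max_def Suc_le_eq)

text \<open>Beyond \<open>m_max < KT\<close> more copies do not help: \<open>m_max * nT\<close>
  antennas already serve all \<open>KR\<close> users, and \<open>1 / KR\<close> is the smallest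
  possible value.\<close>

lemma edge_time_m_max_le:
  assumes "1 \<le> m" "m \<le> KT"
  shows "edge_time m_max \<le> edge_time m"
proof (cases "m \<le> m_max \<or> m_max = KT")
  case True
  then show ?thesis
  proof
    assume "m_max = KT"
    then show ?thesis using assms edge_time_antimono[of m m_max] by simp
  next
    assume "m \<le> m_max"
    then show ?thesis using assms edge_time_antimono[of m m_max] by simp
  qed
next
  case False
  then have "real KR / real nT \<le> real m_max"
    unfolding m_max_def by linarith
  then have "KR \<le> m_max * nT"
    using nT_pos by (simp add: field_simps flip: of_nat_mult)
  then have "edge_time m_max = 1 / real KR"
    by (simp add: edge_time_def)
  then show ?thesis using edge_time_eq_max[OF assms(1)] by simp
qed

section \<open>Comparison of the scheme with the cost of a single packet\<close>

context
  fixes near :: "real \<Rightarrow> nat" and r :: real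
  assumes near: "nearest_positive_rounding near" and r_nonneg: "0 \<le> r"
begin

text \<open>The threshold is the rate at which the unrounded multiplicity reaches
  \<open>m_max\<close>.\<close>

lemma r_less_r_th_iff: "r < r_th \<longleftrightarrow> sqrt (real KT * r / real nT) < real m_max"
proof -
  have "r < r_th \<longleftrightarrow> real KT * r / real nT < (real m_max)\<^sup>2"
    using KT_pos nT_pos by (simp add: r_th_def field_simps)
  also have "\<dots> \<longleftrightarrow> sqrt (real KT * r / real nT) < real m_max"
    using real_sqrt_less_iff[of "real KT * r / real nT" "(real m_max)\<^sup>2"] by simp
  finally show ?thesis .
qed

lemma m_rate_ge_1: "m_rate near r \<ge> 1"
  using m_max_ge_1 nearest_positive_rounding_ge_1[OF near] by (simp add: m_rate_def)

text \<open>Below the threshold this is the rounding error; above it, \<open>m_rate\<close> is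
  \<open>m_max\<close>, which is at most the square root.\<close>

lemma m_rate_lower:
  assumes "m_rate near r \<ge> 2"
  shows "real nT * (real (m_rate near r) - 1 / 2)\<^sup>2 \<le> real KT * r"
proof -
  have "real (m_rate near r) - 1 / 2 \<le> sqrt (real KT * r / real nT)"
    using assms nearest_positive_rounding_lower[OF near] r_less_r_th_iff
    by (auto simp: m_rate_def)
  then have "(real (m_rate near r) - 1 / 2)\<^sup>2 \<le> (sqrt (real KT * r / real nT))\<^sup>2"
    using assms by (intro power_mono) auto
  then show ?thesis using r_nonneg nT_pos by (simp add: field_simps)
qed

lemma m_rate_upper:
  assumes "m_rate near r \<noteq> m_max"
  shows "real KT * r \<le> real nT * (real (m_rate near r) + 1 / 2)\<^sup>2"
proof -
  have "sqrt (real KT * r / real nT) \<le> real (m_rate near r) + 1 / 2"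
    using assms nearest_positive_rounding_upper[OF near]
    by (auto simp: m_rate_def)
  then have "(sqrt (real KT * r / real nT))\<^sup>2 \<le> (real (m_rate near r) + 1 / 2)\<^sup>2"
    using r_nonneg by (intro power_mono) auto
  then show ?thesis using r_nonneg nT_pos by (simp add: field_simps)
qed

lemma m_rate_le_m_max: "m_rate near r \<le> m_max"
proof (rule ccontr)
  assume "\<not> ?thesis"
  then have *: "r < r_th" "near (sqrt (real KT * r / real nT)) > m_max"
    by (auto simp: m_rate_def split: if_splits)
  then have "real (near (sqrt (real KT * r / real nT))) - 1 / 2 \<le> sqrt (real KT * r / real nT)"
    using m_max_ge_1 by (intro nearest_positive_rounding_lower[OF near]) auto
  then show False using * r_less_r_th_iff by linarith
qed

text \<open>
  Let \<open>s = sqrt (KT * r / nT)\<close>, the real minimiser of \<open>M / (KT * r) + 1 / (M * nT)\<close>.  Of the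
  rounding, the next two lemmas use only \<open>s \<le> m_rate + 1 / 2\<close> (unless \<open>m_rate = m_max\<close>) and
  \<open>s \<ge> m_rate - 1 / 2\<close>, respectively.
\<close>

lemma edge_time_le_above_m_rate:
  assumes "0 < r" "m_rate near r \<le> j" "j \<le> m" "m \<le> KT"
  shows "edge_time j \<le> 3 / 2 * ((real m - real j) / (real KT * r) + edge_time m)"
proof -
  have j1: "j \<ge> 1" using assms(2) m_rate_ge_1 by simp
  have pos: "0 \<le> (real m - real j) / (real KT * r)" "0 < edge_time m"
    using assms j1 KR_pos nT_pos by (auto simp: edge_time_def)
  have le: ?thesis if "edge_time j \<le> edge_time m"
  proof -
    have "e \<le> 3 / 2 * (x + e')" if "e \<le> e'" "0 \<le> x" "0 < e'" for e e' x :: real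
      using that by (simp add: algebra_simps)
    then show ?thesis using that pos by blast
  qed
  \<comment> \<open>In the first three cases extra copies bring no gain in edge time. Only the
    fourth weighs such a gain against the fronthaul.\<close>
  consider "m_rate near r = m_max" | "edge_time j = 1 / real KR" | "j = m"
    | "m_rate near r \<noteq> m_max" "edge_time j = 1 / (real j * real nT)" "j < m"
  proof -
    have "edge_time j = 1 / real KR \<or> edge_time j = 1 / (real j * real nT)"
      using edge_time_eq_max[OF j1] by (simp add: max_def)
    then show ?thesis
      using that assms(3) by (metis le_neq_implies_less)
  qed
  then show ?thesis
  proof cases
    case 1
    then have "edge_time j \<le> edge_time m_max" "edge_time m_max \<le> edge_time m"
      using assms edge_time_antimono[of m_max j] edge_time_m_max_le[of m] m_max_ge_1 j1 by auto
    then show ?thesis by (intro le) linarith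
  next
    case 2
    then show ?thesis using edge_time_eq_max[of m] j1 assms(3) by (intro le) simp
  next
    case 3
    then show ?thesis by (intro le) simp
  next
    case 4
    define a d where "a = real j" and "d = real m - real j"
    have a: "a \<ge> 1" and d: "d \<ge> 1"
      using j1 4(3) by (auto simp: a_def d_def)
    \<comment> \<open>As \<open>1 / a - 1 / (a + d) = d / (a * (a + d))\<close>, it suffices that
      \<open>(a + 1 / 2)\<^sup>2\<close> is at most 3/2 times \<open>a * (a + d)\<close>, which
      holds for \<open>a, d >= 1\<close>.\<close>
    have "1 / a \<le> 3 / 2 * (d / (a + 1 / 2)\<^sup>2 + 1 / (a + d))"
    proof -
      have "(a + 1 / 2)\<^sup>2 \<le> 3 / 2 * (a * (a + d))"
      proof -
        have "a * 1 \<le> a * d" "1 * 1 \<le> a * a" using a d by (intro mult_mono; simp)+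
        moreover have "(a + 1 / 2)\<^sup>2 = a * a + a + 1 / 4" "a * (a + d) = a * a + a * d"
          by (simp_all add: power2_eq_square algebra_simps)
        ultimately show ?thesis using a by linarith
      qed
      then have "d / (3 / 2 * (a * (a + d))) \<le> d / (a + 1 / 2)\<^sup>2"
        using a d by (intro divide_left_mono) auto
      moreover have "3 / 2 * (d / (3 / 2 * (a * (a + d)))) = d / (a * (a + d))" by simp
      moreover have "1 / a = d / (a * (a + d)) + 1 / (a + d)"
      proof -
        have "a \<noteq> 0" "a + d \<noteq> 0" using a d by auto
        then show ?thesis by (simp add: divide_simps)
      qed
      moreover have "1 / (a + d) \<ge> 0" using a d by simp
      ultimately show ?thesis
        using a d by argo
    qed
    then have "1 / a / real nT \<le> 3 / 2 * (d / (a + 1 / 2)\<^sup>2 + 1 / (a + d)) / real nT"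
      by (rule divide_right_mono) simp
    also have "\<dots> = 3 / 2 * (d / (real nT * (a + 1 / 2)\<^sup>2) + 1 / (real m * real nT))"
      using nT_pos by (simp add: field_simps a_def d_def)
    also have "d / (real nT * (a + 1 / 2)\<^sup>2) \<le> d / (real KT * r)"
    proof (rule divide_left_mono)
      have "real nT * (real (m_rate near r) + 1 / 2)\<^sup>2 \<le> real nT * (a + 1 / 2)\<^sup>2"
        using assms(2) by (intro mult_left_mono power_mono) (auto simp: a_def)
      then show "real KT * r \<le> real nT * (a + 1 / 2)\<^sup>2"
        using m_rate_upper 4(1) by linarith
    qed (use d assms(1) KT_pos nT_pos a in auto)
    also have "1 / (real m * real nT) \<le> edge_time m"
      using edge_time_eq_max[of m] j1 assms(3) by simp
    finally show ?thesis using 4(2) by (simp add: a_def d_def)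
  qed
qed

lemma edge_time_le_below_m_rate:
  assumes "0 < r" "1 \<le> m" "m < m_rate near r"
  shows "(real (m_rate near r) - real m) / (real KT * r) + edge_time (m_rate near r)
    \<le> 3 / 2 * edge_time m"
proof -
  define a b where "a = real m" and "b = real (m_rate near r)"
  have a: "a \<ge> 1" and ab: "b \<ge> a + 1"
    using assms by (auto simp: a_def b_def)
  \<comment> \<open>The square gives \<open>2 * a * (b - a) <= b * b / 2\<close>, and
    \<open>b >= 2\<close> gives \<open>b * b / 2 <= b * b - b\<close>. The fronthaul term is thus at
    most half of \<open>1 / (m * nT)\<close>, whence the factor 3/2.\<close>
  have "2 * a * (b - a) \<le> (b - 1 / 2)\<^sup>2"
  proof -
    have "0 \<le> (b - 2 * a)\<^sup>2" "2 * b \<le> b * b"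
      using a ab by (auto intro: mult_right_mono)
    then show ?thesis by (simp add: power2_eq_square algebra_simps)
  qed
  then have "real nT * (2 * a * (b - a)) \<le> real nT * (b - 1 / 2)\<^sup>2"
    by (rule mult_left_mono) simp
  also have "\<dots> \<le> real KT * r"
    using m_rate_lower assms by (simp add: b_def)
  finally have "(b - a) / (real KT * r) \<le> 1 / 2 * (1 / (real m * real nT))"
    using a nT_pos KT_pos assms(1) by (simp add: field_simps a_def)
  moreover have "1 / (real m * real nT) \<le> edge_time m"
    using edge_time_eq_max[of m] assms(2) by simp
  ultimately show ?thesis
    using edge_time_antimono[of m "m_rate near r"] assms unfolding a_def b_def by linarith
qed

text \<open>The scheme raises \<open>c\<close> to \<open>M = m_rate\<close> if \<open>c < M\<close>
  and uses no fronthaul otherwise. If \<open>c < M\<close>, the fronthaul cost common to both sides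
  is split off, leaving a comparison of \<open>M\<close> with \<open>m\<close>.\<close>

lemma scheme_NDT_le:
  assumes "c \<le> m" "1 \<le> m" "m \<le> KT" "r = 0 \<Longrightarrow> m = c"
  shows "scheme_NDT near (real c / real KT) r
    \<le> ereal (3 / 2 * real KR * ((real m - real c) / (real KT * r) + edge_time m))"
proof -
  define M where "M = m_rate near r"
  have x: "real c / real KT * real KT = real c" using KT_pos by simp
  show ?thesis
  proof (cases "c < M")
    case True
    \<comment> \<open>At \<open>r = 0\<close>, \<open>c = m >= 1\<close> forces
      \<open>M >= 2\<close>, and \<open>m_rate_lower\<close> would bound a positive number by
      0.\<close>
    have "r \<noteq> 0"
    proof
      assume "r = 0"
      then have "M \<ge> 2" using assms True by auto
      then show False using m_rate_lower \<open>r = 0\<close> nT_pos unfolding M_def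
        by (simp add: mult_le_0_iff)
    qed
    then have r: "r > 0" using r_nonneg by simp
    have "scheme_NDT near (real c / real KT) r
        = ereal (real KR * ((real M - real c) / (real KT * r) + edge_time M))"
      using True r KT_pos
      unfolding scheme_NDT_def multiplicity_m_def x
      by (simp add: M_def[symmetric] edge_time_def algebra_simps)
    moreover have "(real M - real c) / (real KT * r) + edge_time M
      \<le> 3 / 2 * ((real m - real c) / (real KT * r) + edge_time m)"
    proof (cases "M \<le> m")
      case True
      then have "edge_time M \<le> 3 / 2 * ((real m - real M) / (real KT * r) + edge_time m)"
        using edge_time_le_above_m_rate[of M m] r assms(3) by (simp add: M_def)
      moreover have "0 \<le> (real M - real c) / (real KT * r)" using \<open>c < M\<close> r by simp
      moreover have "(real m - real c) / (real KT * r)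
          = (real m - real M) / (real KT * r) + (real M - real c) / (real KT * r)"
        by (simp flip: add_divide_distrib)
      ultimately show ?thesis by argo
    next
      case False
      then have "(real M - real m) / (real KT * r) + edge_time M \<le> 3 / 2 * edge_time m"
        using edge_time_le_below_m_rate[of m] r assms(2) by (simp add: M_def)
      moreover have "0 \<le> (real m - real c) / (real KT * r)" using assms(1) r by simp
      moreover have "(real M - real c) / (real KT * r)
          = (real M - real m) / (real KT * r) + (real m - real c) / (real KT * r)"
        by (simp flip: add_divide_distrib)
      ultimately show ?thesis by argo
    qed
    ultimately show ?thesis
      using KR_pos by (simp add: mult.commute mult.left_commute mult_left_mono)
  next
    case False
    then have c1: "c \<ge> 1" using m_rate_ge_1 by (simp add: M_def)
    \<comment> \<open>The fronthaul numerator is 0 here, and so is its quotient in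
      \<open>ereal\<close>, even for \<open>r = 0\<close>.\<close>
    have "scheme_NDT near (real c / real KT) r = ereal (real KR * edge_time (min c m_max))"
      using False m_rate_le_m_max
      unfolding scheme_NDT_def multiplicity_m_def x
      by (simp add: M_def[symmetric] edge_time_def min_def zero_ereal_def[symmetric])
    moreover have "edge_time (min c m_max) \<le> edge_time c"
      using edge_time_m_max_le[of c] c1 assms by (simp add: min_def)
    moreover have "edge_time c \<le> 3 / 2 * ((real m - real c) / (real KT * r) + edge_time m)"
    proof (cases "r = 0")
      case True
      then have "m = c" using assms by simp
      moreover have "0 \<le> edge_time c" by (simp add: edge_time_def)
      ultimately show ?thesis by simp
    next
      case r: False
      then show ?thesis
        using edge_time_le_above_m_rate[of c m] assms r_nonneg False by (simp add: M_def)
    qed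
    ultimately show ?thesis
      using KR_pos by (simp add: mult.commute mult.left_commute mult_left_mono)
  qed
qed

lemma multiplicity_m_ge_1: "multiplicity_m near \<mu> r \<ge> 1"
proof -
  have "1 \<le> nat \<lfloor>\<mu> * real KT\<rfloor>" if "\<not> \<mu> * real KT < real (m_rate near r)"
    using that m_rate_ge_1 by linarith
  then show ?thesis using m_rate_ge_1 m_max_ge_1 by (simp add: multiplicity_m_def)
qed

text \<open>This makes the constant 1 a convex minorant, so the achievable NDT is positive; scaling
  it and dividing then stay clear of negative values.\<close>

lemma scheme_NDT_ge_1: "1 \<le> scheme_NDT near \<mu> r"
proof -
  define m where "m = multiplicity_m near \<mu> r"
  have "1 \<le> real KR / real (min (m * nT) KR)"
    using multiplicity_m_ge_1[of \<mu>] KR_pos nT_pos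
    unfolding m_def[symmetric] by (auto simp: divide_simps min_def)
  moreover have "0 \<le> ereal (real KR * max (real m - of_int \<lfloor>\<mu> * real KT\<rfloor>) 0) / ereal (real KT * r)"
    using r_nonneg by (simp add: divide_ereal_def)
  ultimately show ?thesis
    unfolding scheme_NDT_def m_def[symmetric]
    by (metis add_increasing ereal_less_eq(3) one_ereal_def)
qed

end

end

section \<open>Lower convex envelopes\<close>

text \<open>Taking only real heights puts the epigraph into the real plane, where results on convex
  sets apply although \<open>g\<close> may be infinite.\<close>

lemma ereal_convex_on_convex_epigraph:
  assumes "ereal_convex_on S g"
  shows "convex {(x, y :: real). x \<in> S \<and> g x \<le> ereal y}"
  unfolding convex_alt
proof (intro ballI allI impI)
  fix p p' :: "real \<times> real" and t :: real
  assume "p \<in> {(x, y). x \<in> S \<and> g x \<le> ereal y}" "p' \<in> {(x, y). x \<in> S \<and> g x \<le> ereal y}"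
    and t': "0 \<le> t \<and> t \<le> 1"
  then obtain x y x' y' where p: "p = (x, y)" "p' = (x', y')"
    and x: "x \<in> S" "g x \<le> ereal y" and x': "x' \<in> S" "g x' \<le> ereal y'"
    by blast
  from t' have t: "0 \<le> t" "t \<le> 1" by auto
  have "g ((1 - t) * x + t * x') \<le> ereal (1 - t) * g x + ereal t * g x'"
    using assms x x' t by (auto simp: ereal_convex_on_def)
  also have "\<dots> \<le> ereal (1 - t) * ereal y + ereal t * ereal y'"
    using x x' t by (intro add_mono ereal_mult_left_mono) auto
  finally have "g ((1 - t) * x + t * x') \<le> ereal ((1 - t) * y + t * y')" by simp
  moreover have "(1 - t) * x + t * x' \<in> S"
    using assms x x' t by (auto simp: ereal_convex_on_def convex_alt)
  ultimately show "(1 - t) *\<^sub>R p + t *\<^sub>R p' \<in> {(x, y). x \<in> S \<and> g x \<le> ereal y}"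
    by (simp add: p)
qed

lemma ereal_convex_on_jensen:
  assumes "ereal_convex_on S g" "finite P"
    and "(\<Sum>p\<in>P. w p) = 1" "\<And>p. p \<in> P \<Longrightarrow> 0 \<le> w p"
    and "\<And>p. p \<in> P \<Longrightarrow> x p \<in> S" "\<And>p. p \<in> P \<Longrightarrow> g (x p) \<le> ereal (y p)"
  shows "g (\<Sum>p\<in>P. w p * x p) \<le> ereal (\<Sum>p\<in>P. w p * y p)"
proof -
  have "(\<Sum>p\<in>P. w p *\<^sub>R (x p, y p)) \<in> {(x, y). x \<in> S \<and> g x \<le> ereal y}"
    by (rule convex_sum[OF assms(2) ereal_convex_on_convex_epigraph[OF assms(1)]]) (use assms in auto)
  moreover have "(\<Sum>p\<in>P. w p *\<^sub>R (x p, y p)) = (\<Sum>p\<in>P. w p * x p, \<Sum>p\<in>P. w p * y p)"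
    by (simp add: sum_prod)
  ultimately show ?thesis by auto
qed

text \<open>A substitute for monotonicity: \<open>z\<close> lies between \<open>x\<close> and 1, so
  a common bound at these two points passes to \<open>z\<close>.\<close>

lemma ereal_convex_on_le_right_end:
  assumes g: "ereal_convex_on {0..1} g" and x: "0 \<le> x" "x \<le> z" "z \<le> 1"
    and "g x \<le> ereal y" "g 1 \<le> ereal y"
  shows "g z \<le> ereal y"
proof (cases "x = 1")
  case True
  then show ?thesis using assms by simp
next
  case False
  define t where "t = (z - x) / (1 - x)"
  have t: "0 \<le> t" "t \<le> 1" using x False by (auto simp: t_def divide_le_eq)
  have "t * (1 - x) = z - x" using False x by (simp add: t_def)
  then have z: "z = (1 - t) * x + t * 1" by (simp add: algebra_simps)
  have "((1 - t) *\<^sub>R (x, y) + t *\<^sub>R (1, y)) \<in> {(x, y). x \<in> {0..1} \<and> g x \<le> ereal y}"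
    by (rule convexD_alt[OF ereal_convex_on_convex_epigraph[OF g]]) (use assms t in auto)
  moreover have "(1 - t) *\<^sub>R (x, y) + t *\<^sub>R (1, y) = (z, y)"
    using z by (simp add: algebra_simps)
  ultimately show ?thesis by simp
qed

lemma ereal_convex_on_envelope:
  assumes "convex S"
  shows "ereal_convex_on S (lower_convex_envelope S f)"
  unfolding ereal_convex_on_def
proof (intro conjI ballI)
  fix x y t :: real
  assume *: "x \<in> S" "y \<in> S" "t \<in> {0..1}"
  show "lower_convex_envelope S f ((1 - t) * x + t * y)
    \<le> ereal (1 - t) * lower_convex_envelope S f x + ereal t * lower_convex_envelope S f y"
    unfolding lower_convex_envelope_def
  proof (rule SUP_least)
    fix g assume g: "g \<in> {g. ereal_convex_on S g \<and> (\<forall>y\<in>S. g y \<le> f y)}"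
    then have "g ((1 - t) * x + t * y) \<le> ereal (1 - t) * g x + ereal t * g y"
      using * by (auto simp: ereal_convex_on_def)
    also have "\<dots> \<le> ereal (1 - t) * (SUP g\<in>{g. ereal_convex_on S g \<and> (\<forall>y\<in>S. g y \<le> f y)}. g x)
        + ereal t * (SUP g\<in>{g. ereal_convex_on S g \<and> (\<forall>y\<in>S. g y \<le> f y)}. g y)"
      using * g by (intro add_mono ereal_mult_left_mono SUP_upper) auto
    finally show "g ((1 - t) * x + t * y) \<le> \<dots>" .
  qed
qed fact

lemma ereal_convex_on_cmult:
  assumes "ereal_convex_on S g" "0 \<le> c" "\<And>x. x \<in> S \<Longrightarrow> 0 \<le> g x"
  shows "ereal_convex_on S (\<lambda>x. ereal c * g x)"
  unfolding ereal_convex_on_def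
proof (intro conjI ballI)
  fix x y t :: real
  assume *: "x \<in> S" "y \<in> S" "t \<in> {0..1}"
  then have "g ((1 - t) * x + t * y) \<le> ereal (1 - t) * g x + ereal t * g y"
    using assms(1) by (auto simp: ereal_convex_on_def)
  then have "ereal c * g ((1 - t) * x + t * y) \<le> ereal c * (ereal (1 - t) * g x + ereal t * g y)"
    using assms(2) by (intro ereal_mult_left_mono) auto
  also have "\<dots> = ereal (1 - t) * (ereal c * g x) + ereal t * (ereal c * g y)"
    using * assms(3) by (subst ereal_right_distrib) (auto simp: mult.left_commute)
  finally show "ereal c * g ((1 - t) * x + t * y) \<le> \<dots>" .
qed (use assms(1) in \<open>simp add: ereal_convex_on_def\<close>)

lemma lower_convex_envelope_ge:
  assumes "ereal_convex_on S g" "\<And>y. y \<in> S \<Longrightarrow> g y \<le> f y"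
  shows "g x \<le> lower_convex_envelope S f x"
  unfolding lower_convex_envelope_def by (rule SUP_upper) (use assms in auto)

lemma ereal_convex_on_const: "convex S \<Longrightarrow> ereal_convex_on S (\<lambda>_. ereal c)"
  unfolding ereal_convex_on_def by (auto simp: algebra_simps)

section \<open>The converse\<close>

lemma sum_card_swap:
  "finite A \<Longrightarrow> finite B \<Longrightarrow>
    (\<Sum>a\<in>A. card {b \<in> B. R a b}) = (\<Sum>b\<in>B. card {a \<in> A. R a b})"
  using sum.swap_restrict[of A B "\<lambda>_ _. 1 :: nat" R] by simp

context fran
begin

text \<open>A request vector with pairwise distinct files, so the requested packets are
  \<open>{..<KR} \<times> {..<F}\<close> and the first component of a packet is both its file and
  its user.\<close>

definition identity_request :: "nat \<Rightarrow> nat" where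
  "identity_request = restrict (\<lambda>k. k) {..<KR}"

text \<open>This is the \<open>c\<close> of the outline, and \<open>total_count\<close> its
  \<open>m\<close>. Looking only at the cache for the packet's own file loses nothing under a valid
  caching.\<close>

definition cache_count :: "(nat \<Rightarrow> nat \<Rightarrow> packet set) \<Rightarrow> packet \<Rightarrow> nat" where
  "cache_count C x = card {i \<in> {..<KT}. x \<in> C i (fst x)}"

definition total_count :: "(nat \<Rightarrow> nat \<Rightarrow> packet set) \<Rightarrow> delivery \<Rightarrow> packet \<Rightarrow> nat" where
  "total_count C D x = card {i \<in> {..<KT}. x \<in> available C D i}"

lemma identity_request_in_requests: "identity_request \<in> requests"
  using N_ge_KR by (auto simp: identity_request_def requests_def)

lemma cache_count_le_total_count:
  assumes "fst x < N"
  shows "cache_count C x \<le> total_count C D x"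
  unfolding cache_count_def total_count_def using assms
  by (intro card_mono) (auto simp: available_def)

lemma total_count_le_KT: "total_count C D x \<le> KT"
  using card_mono[of "{..<KT}" "{i \<in> {..<KT}. x \<in> available C D i}"]
  by (auto simp: total_count_def)

lemma available_iff:
  assumes "valid_caching \<mu> F C" "i < KT" "fst x < N"
  shows "x \<in> available C D i \<longleftrightarrow> x \<in> C i (fst x) \<or> x \<in> fronthaul D i"
proof -
  have "n = fst x" if "n < N" "x \<in> C i n" for n
    using assms(1,2) that by (force simp: valid_caching_def file_packets_def)
  then show ?thesis using assms(3) by (auto simp: available_def)
qed

text \<open>Count pairs of an edge node and a packet it caches: each of the \<open>KT\<close> nodes
  holds at most \<open>\<mu> * F\<close> packets of each of the \<open>KR\<close> files.\<close>

lemma sum_cache_count_le: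
  assumes "valid_caching \<mu> F C"
  shows "(\<Sum>x\<in>{..<KR} \<times> {..<F}. real (cache_count C x)) \<le> real KT * real KR * \<mu> * real F"
proof -
  have "(\<Sum>x\<in>{..<KR} \<times> {..<F}. real (cache_count C x))
      = real (\<Sum>i<KT. card {x \<in> {..<KR} \<times> {..<F}. x \<in> C i (fst x)})"
    unfolding cache_count_def of_nat_sum[symmetric]
    by (rule arg_cong[where f = real], rule sum_card_swap) auto
  also have "\<dots> \<le> (\<Sum>i<KT. real KR * (\<mu> * real F))"
    unfolding of_nat_sum
  proof (rule sum_mono)
    fix i assume i: "i \<in> {..<KT}"
    have fin: "finite (C i k)" if "k < KR" for k
      using assms i that N_ge_KR finite_subset[of "C i k" "file_packets F k"]
      by (auto simp: valid_caching_def file_packets_def)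
    have "card {x \<in> {..<KR} \<times> {..<F}. x \<in> C i (fst x)} \<le> card (\<Union>k<KR. C i k)"
      using fin by (intro card_mono) auto
    also have "\<dots> \<le> (\<Sum>k<KR. card (C i k))"
      by (rule card_UN_le) simp
    finally have "real (card {x \<in> {..<KR} \<times> {..<F}. x \<in> C i (fst x)}) \<le> (\<Sum>k<KR. real (card (C i k)))"
      unfolding of_nat_sum[symmetric] by (rule of_nat_mono)
    also have "\<dots> \<le> (\<Sum>k<KR. \<mu> * real F)"
      using assms i N_ge_KR by (intro sum_mono) (auto simp: valid_caching_def)
    finally show "real (card {x \<in> {..<KR} \<times> {..<F}. x \<in> C i (fst x)}) \<le> real KR * (\<mu> * real F)"
      by simp
  qed
  finally show ?thesis by (simp add: mult_ac)
qed

text \<open>Every copy beyond the cached ones came over the fronthaul; summing over packets and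
  swapping the sums gives the total load.\<close>

lemma sum_fronthaul_ge:
  assumes C: "valid_caching \<mu> F C" and D: "valid_fronthaul r F d D"
  shows "(\<Sum>x\<in>{..<KR} \<times> {..<F}. real (total_count C D x) - real (cache_count C x))
    \<le> (\<Sum>i<KT. real (card (fronthaul D i)))"
proof -
  let ?P = "{..<KR} \<times> {..<F}"
  have "real (total_count C D x) - real (cache_count C x)
      \<le> real (card {i \<in> {..<KT}. x \<in> fronthaul D i})" if "x \<in> ?P" for x
  proof -
    have "fst x < N" using that N_ge_KR by auto
    then have "{i \<in> {..<KT}. x \<in> available C D i}
        = {i \<in> {..<KT}. x \<in> C i (fst x)} \<union> {i \<in> {..<KT}. x \<in> fronthaul D i}"
      using available_iff[OF C, of _ x D] by auto
    then have "total_count C D x \<le> cache_count C x + card {i \<in> {..<KT}. x \<in> fronthaul D i}"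
      unfolding total_count_def cache_count_def by (simp add: card_Un_le)
    then show ?thesis by simp
  qed
  then have "(\<Sum>x\<in>?P. real (total_count C D x) - real (cache_count C x))
      \<le> (\<Sum>x\<in>?P. real (card {i \<in> {..<KT}. x \<in> fronthaul D i}))"
    by (rule sum_mono)
  also have "\<dots> = real (\<Sum>i<KT. card {x \<in> ?P. x \<in> fronthaul D i})"
    unfolding of_nat_sum[symmetric]
    by (rule arg_cong[where f = real], rule sum_card_swap) auto
  also have "\<dots> \<le> (\<Sum>i<KT. real (card (fronthaul D i)))"
    unfolding of_nat_sum
  proof (rule sum_mono)
    fix i assume "i \<in> {..<KT}"
    then have "fronthaul D i \<subseteq> (\<Union>k<KR. file_packets F (d k))"
      using D by (simp add: valid_fronthaul_def)
    then have "finite (fronthaul D i)"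
      by (rule finite_subset) (simp add: file_packets_def)
    then show "real (card {x \<in> ?P. x \<in> fronthaul D i}) \<le> real (card (fronthaul D i))"
      by (auto intro!: card_mono)
  qed
  finally show ?thesis .
qed

lemma served_card_le:
  assumes D: "valid_edge F C d D" and b: "b < num_blocks D" and k: "k \<in> served D b"
  shows "card (served D b) \<le> min (total_count C D (sent D b k) * nT) KR"
proof (rule min.boundedI)
  have R: "served D b \<subseteq> {..<KR}" using D b by (auto simp: valid_edge_def)
  then show "card (served D b) \<le> KR"
    using card_mono[of "{..<KR}" "served D b"] by simp
  show "card (served D b) \<le> total_count C D (sent D b k) * nT"
    unfolding total_count_def
    by (rule zero_forcing_bound[OF R k, where v = "\<lambda>i. precoder D b i k" and b = b])
      (use D b k in \<open>auto simp: valid_edge_def\<close>)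
qed

text \<open>The block serves at least one user, so the bound \<open>m * nT\<close> on its size
  cannot be 0.\<close>

lemma total_count_ge_1:
  assumes "valid_edge F C d D" "b < num_blocks D" "k \<in> served D b"
  shows "1 \<le> total_count C D (sent D b k)"
proof -
  have "served D b \<subseteq> {..<KR}" using assms by (auto simp: valid_edge_def)
  then have "0 < card (served D b)"
    using assms(3) by (auto simp: card_gt_0_iff finite_subset)
  then show ?thesis using served_card_le[OF assms] by (cases "total_count C D (sent D b k)") auto
qed

text \<open>Assign to each packet \<open>x\<close> one block \<open>\<beta> x\<close> that delivers
  it, and charge it an equal share of that block; the charges to a block sum to at most 1.\<close>

lemma sum_edge_time_le:
  assumes D: "valid_edge F C identity_request D"
    and complete: "complete_delivery F identity_request D"
  shows "(\<Sum>x\<in>{..<KR} \<times> {..<F}. edge_time (total_count C D x)) \<le> real (num_blocks D)"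
    and "\<And>x. x \<in> {..<KR} \<times> {..<F} \<Longrightarrow> 1 \<le> total_count C D x"
proof -
  let ?P = "{..<KR} \<times> {..<F}"
  have "\<exists>b. b < num_blocks D \<and> fst x \<in> served D b \<and> sent D b (fst x) = x" if "x \<in> ?P" for x
  proof -
    have "x \<in> file_packets F (identity_request (fst x))"
      using that by (auto simp: file_packets_def identity_request_def)
    moreover have "fst x < KR" using that by auto
    ultimately have "x \<in> {sent D b (fst x) | b. b < num_blocks D \<and> fst x \<in> served D b}"
      using complete unfolding complete_delivery_def by blast
    then show ?thesis by auto
  qed
  then obtain \<beta> where \<beta>: "\<And>x. x \<in> ?P \<Longrightarrow>
      \<beta> x < num_blocks D \<and> fst x \<in> served D (\<beta> x) \<and> sent D (\<beta> x) (fst x) = x"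
    by metis
  show "1 \<le> total_count C D x" if "x \<in> ?P" for x
    using total_count_ge_1[OF D, of "\<beta> x" "fst x"] \<beta>[OF that] by simp
  have fin: "finite (served D b)" if "b < num_blocks D" for b
    using D that finite_subset[of "served D b" "{..<KR}"] by (auto simp: valid_edge_def)
  have "(\<Sum>x\<in>?P. edge_time (total_count C D x)) \<le> (\<Sum>x\<in>?P. 1 / real (card (served D (\<beta> x))))"
  proof (rule sum_mono)
    fix x assume "x \<in> ?P"
    note b = \<beta>[OF this]
    have "0 < card (served D (\<beta> x))"
      using b fin by (auto simp: card_gt_0_iff)
    moreover have "card (served D (\<beta> x)) \<le> min (total_count C D x * nT) KR"
      using served_card_le[OF D, of "\<beta> x" "fst x"] b by simp
    ultimately show "edge_time (total_count C D x) \<le> 1 / real (card (served D (\<beta> x)))"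
      unfolding edge_time_def
      by (intro divide_left_mono mult_pos_pos) (linarith | simp del: of_nat_min)+
  qed
  also have "\<dots> = (\<Sum>(b, k)\<in>(\<lambda>x. (\<beta> x, fst x)) ` ?P. 1 / real (card (served D b)))"
  proof (subst sum.reindex)
    \<comment> \<open>A block carries one packet per user, so \<open>x\<close> is recovered as
      \<open>sent D (\<beta> x) (fst x)\<close>.\<close>
    show "inj_on (\<lambda>x. (\<beta> x, fst x)) ?P"
      by (rule inj_onI) (metis \<beta> prod.inject)
  qed simp
  also have "\<dots> \<le> (\<Sum>(b, k)\<in>(SIGMA b:{..<num_blocks D}. served D b). 1 / real (card (served D b)))"
  proof (rule sum_mono2)
    show "finite (SIGMA b:{..<num_blocks D}. served D b)" using fin by auto
    show "(\<lambda>x. (\<beta> x, fst x)) ` ?P \<subseteq> (SIGMA b:{..<num_blocks D}. served D b)" using \<beta> by auto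
  qed auto
  also have "\<dots> = (\<Sum>b<num_blocks D. \<Sum>k\<in>served D b. 1 / real (card (served D b)))"
    using fin by (subst sum.Sigma) auto
  also have "\<dots> \<le> (\<Sum>b<num_blocks D. 1)"
    by (rule sum_mono) simp
  finally show "(\<Sum>x\<in>?P. edge_time (total_count C D x)) \<le> real (num_blocks D)" by simp
qed

lemma policy_NDT_ge:
  assumes "d \<in> requests"
  shows "fronthaul_NDT r (num_packets p) (deliver p d) + edge_NDT (num_packets p) (deliver p d)
    \<le> policy_NDT r p"
proof -
  have "finite requests" by (simp add: requests_def finite_PiE)
  then show ?thesis unfolding policy_NDT_def using assms by (intro Max_ge) auto
qed

lemma sum_le_policy_NDT:
  assumes p: "valid_policy \<mu> r p" and r: "0 \<le> r"
    and F: "F = num_packets p" and C: "C = cached p" and D: "D = deliver p identity_request"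
  shows "(\<Sum>x\<in>{..<KR} \<times> {..<F}.
      (real (total_count C D x) - real (cache_count C x)) / (real KT * r) + edge_time (total_count C D x))
    \<le> real F * policy_NDT r p"
proof -
  have valid: "valid_caching \<mu> F C" "valid_fronthaul r F identity_request D"
      "valid_edge F C identity_request D" "complete_delivery F identity_request D" "F \<ge> 1"
    using p identity_request_in_requests by (auto simp: valid_policy_def F C D)
  have "(\<Sum>x\<in>{..<KR} \<times> {..<F}. real (total_count C D x) - real (cache_count C x)) / (real KT * r)
      \<le> real F * fronthaul_NDT r F D"
  proof (cases "r = 0")
    \<comment> \<open>Division by 0 makes the left side 0, in accordance with the zero fronthaul
      NDT.\<close>
    case True
    then show ?thesis by (simp add: fronthaul_NDT_def)
  next
    case False
    define L where "L = (MAX i\<in>{..<KT}. real (card (fronthaul D i)))"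
    have "(\<Sum>i<KT. real (card (fronthaul D i))) \<le> (\<Sum>i<KT. L)"
      unfolding L_def by (intro sum_mono Max_ge) auto
    then have "(\<Sum>x\<in>{..<KR} \<times> {..<F}. real (total_count C D x) - real (cache_count C x)) \<le> real KT * L"
      using sum_fronthaul_ge[OF valid(1,2)] by simp
    then have "(\<Sum>x\<in>{..<KR} \<times> {..<F}. real (total_count C D x) - real (cache_count C x)) / (real KT * r)
      \<le> real KT * L / (real KT * r)"
      using r by (intro divide_right_mono) auto
    also have "\<dots> = real F * fronthaul_NDT r F D"
      using False KT_pos valid(5) by (simp add: fronthaul_NDT_def L_def)
    finally show ?thesis .
  qed
  moreover have "(\<Sum>x\<in>{..<KR} \<times> {..<F}. edge_time (total_count C D x)) \<le> real F * edge_NDT F D"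
    using sum_edge_time_le(1)[OF valid(3,4)] valid(5) by (simp add: edge_NDT_def)
  moreover have "real F * (fronthaul_NDT r F D + edge_NDT F D) \<le> real F * policy_NDT r p"
    using policy_NDT_ge[OF identity_request_in_requests] by (intro mult_left_mono) (auto simp: F D)
  ultimately show ?thesis
    by (simp add: sum.distrib sum_divide_distrib distrib_left)
qed

text \<open>Each requested packet gives a cache size \<open>c / KT\<close> and a bound on
  \<open>g\<close> there. Jensen with equal weights bounds \<open>g\<close> at the average cache
  size, which is at most \<open>\<mu>\<close>; the bound at 1 carries this over to
  \<open>\<mu>\<close>.\<close>

lemma convex_minorant_le_policy_NDT:
  assumes near: "nearest_positive_rounding near" and r: "0 \<le> r"
    and \<mu>: "0 \<le> \<mu>" "\<mu> \<le> 1" and p: "valid_policy \<mu> r p"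
    and g: "ereal_convex_on {0..1} g" "\<And>x. x \<in> {0..1} \<Longrightarrow> g x \<le> scheme_NDT near x r"
  shows "g \<mu> \<le> ereal (3 / 2 * policy_NDT r p)"
proof -
  define F C D where "F = num_packets p" and "C = cached p" and "D = deliver p identity_request"
  have valid: "valid_caching \<mu> F C" "valid_fronthaul r F identity_request D"
      "valid_edge F C identity_request D" "complete_delivery F identity_request D" "F \<ge> 1"
    using p identity_request_in_requests by (auto simp: valid_policy_def F_def C_def D_def)
  define P where "P = {..<KR} \<times> {..<F}"
  define w where "w = 1 / (real KR * real F)"
  define c m where "c = cache_count C" and "m = total_count C D"
  define z where "z x = (real (m x) - real (c x)) / (real KT * r) + edge_time (m x)" for x
  have cm: "c x \<le> m x" "1 \<le> m x" "m x \<le> KT" if "x \<in> P" for x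
    using that N_ge_KR cache_count_le_total_count[of x C D] total_count_le_KT
      sum_edge_time_le(2)[OF valid(3,4)]
    by (auto simp: P_def c_def m_def)
  have m_eq: "m x = c x" if "x \<in> P" "r = 0" for x
  proof -
    have "fronthaul D i = {}" if "i < KT" for i
      using valid(2) \<open>r = 0\<close> that by (auto simp: valid_fronthaul_def)
    then have "{i \<in> {..<KT}. x \<in> available C D i} = {i \<in> {..<KT}. x \<in> C i (fst x)}"
      using available_iff[OF valid(1), of _ x D] that(1) N_ge_KR by (auto simp: P_def)
    then show ?thesis by (simp add: m_def c_def total_count_def cache_count_def)
  qed
  have w: "0 \<le> w" "(\<Sum>x\<in>P. w) = 1"
    using KR_pos valid(5) by (auto simp: w_def P_def)
  have z_sum: "(\<Sum>x\<in>P. w * (3 / 2 * real KR * z x)) \<le> 3 / 2 * policy_NDT r p"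
  proof -
    have "(\<Sum>x\<in>P. w * (3 / 2 * real KR * z x)) = 3 / (2 * real F) * (\<Sum>x\<in>P. z x)"
      unfolding sum_distrib_left by (rule sum.cong) (use KR_pos in \<open>simp_all add: w_def\<close>)
    also have "\<dots> \<le> 3 / (2 * real F) * (real F * policy_NDT r p)"
      using sum_le_policy_NDT[OF p r F_def C_def D_def]
      by (intro mult_left_mono) (auto simp: z_def P_def c_def m_def)
    finally show ?thesis using valid(5) by simp
  qed
  have scheme: "g (real (c x) / real KT) \<le> ereal (3 / 2 * real KR * z x)" if "x \<in> P" for x
  proof -
    have "g (real (c x) / real KT) \<le> scheme_NDT near (real (c x) / real KT) r"
      using cm[of x] that KT_pos by (intro g(2)) auto
    also have "\<dots> \<le> ereal (3 / 2 * real KR * z x)"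
      unfolding z_def using scheme_NDT_le[OF near r, of "c x" "m x"] cm[of x] m_eq[of x] that by simp
    finally show ?thesis .
  qed
  define avg where "avg = (\<Sum>x\<in>P. w * (real (c x) / real KT))"
  have avg: "g avg \<le> ereal (3 / 2 * policy_NDT r p)"
  proof -
    have "g avg \<le> ereal (\<Sum>x\<in>P. w * (3 / 2 * real KR * z x))"
      unfolding avg_def
    proof (rule ereal_convex_on_jensen[OF g(1)])
      show "real (c x) / real KT \<in> {0..1}" if "x \<in> P" for x
        using cm[OF that] KT_pos by simp
    qed (use w scheme in \<open>auto simp: P_def\<close>)
    then show ?thesis using z_sum by (meson ereal_less_eq(3) order_trans)
  qed
  have "0 \<le> avg" unfolding avg_def using w by (intro sum_nonneg) auto
  moreover have "avg \<le> \<mu>"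
  proof -
    have "avg = w / real KT * (\<Sum>x\<in>P. real (c x))"
      by (simp add: avg_def sum_distrib_left)
    also have "\<dots> \<le> w / real KT * (real KT * real KR * \<mu> * real F)"
      using sum_cache_count_le[OF valid(1)] w(1)
      by (intro mult_left_mono) (auto simp: P_def c_def)
    also have "\<dots> = \<mu>" using KR_pos KT_pos valid(5) by (simp add: w_def)
    finally show ?thesis .
  qed
  \<comment> \<open>With everything cached, \<open>c = m = KT\<close>, the cost is
    \<open>edge_time KT\<close>, which is below the cost \<open>z x\<close> of every packet.\<close>
  moreover have "g 1 \<le> ereal (3 / 2 * policy_NDT r p)"
  proof -
    have KTz: "edge_time KT \<le> z x" if "x \<in> P" for x
    proof -
      have "edge_time KT \<le> edge_time (m x)"
        using cm[OF that] by (intro edge_time_antimono) auto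
      moreover have "0 \<le> (real (m x) - real (c x)) / (real KT * r)"
        using cm(1)[OF that] r by simp
      ultimately show ?thesis by (simp add: z_def)
    qed
    have "g 1 \<le> scheme_NDT near (real KT / real KT) r"
      using g(2)[of 1] KT_pos by simp
    also have "\<dots> \<le> ereal (3 / 2 * real KR * edge_time KT)"
      using scheme_NDT_le[OF near r, of KT KT] KT_pos by simp
    also have "3 / 2 * real KR * edge_time KT = (\<Sum>x\<in>P. w * (3 / 2 * real KR * edge_time KT))"
      using w(2) by (simp flip: sum_distrib_right)
    also have "ereal \<dots> \<le> ereal (\<Sum>x\<in>P. w * (3 / 2 * real KR * z x))"
      using KTz w(1) by (simp only: ereal_less_eq) (intro sum_mono mult_left_mono; simp)
    also have "\<dots> \<le> ereal (3 / 2 * policy_NDT r p)" using z_sum by simp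
    finally show ?thesis .
  qed
  ultimately show ?thesis
    using ereal_convex_on_le_right_end[OF g(1), of avg \<mu>] avg \<mu> by blast
qed

lemma achievable_NDT_le_minimum_NDT:
  assumes near: "nearest_positive_rounding near" and r: "0 \<le> r"
    and \<mu>: "0 \<le> \<mu>" "\<mu> \<le> 1"
  shows "1 \<le> achievable_NDT near \<mu> r"
    and "ereal (2 / 3) * achievable_NDT near \<mu> r \<le> minimum_NDT \<mu> r"
proof -
  have ge_1: "1 \<le> achievable_NDT near x r" for x
    unfolding achievable_NDT_def one_ereal_def
    by (rule lower_convex_envelope_ge[OF ereal_convex_on_const])
      (use scheme_NDT_ge_1[OF near r] in \<open>auto simp: one_ereal_def\<close>)
  then show "1 \<le> achievable_NDT near \<mu> r" .
  show "ereal (2 / 3) * achievable_NDT near \<mu> r \<le> minimum_NDT \<mu> r"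
    unfolding minimum_NDT_def
  proof (rule lower_convex_envelope_ge)
    show "ereal_convex_on {0..1} (\<lambda>x. ereal (2 / 3) * achievable_NDT near x r)"
    proof (rule ereal_convex_on_cmult)
      show "0 \<le> achievable_NDT near x r" for x
        by (rule order_trans[OF _ ge_1]) simp
    qed (auto simp: achievable_NDT_def intro: ereal_convex_on_envelope)
    fix x :: real assume x: "x \<in> {0..1}"
    show "ereal (2 / 3) * achievable_NDT near x r \<le> infimum_NDT x r"
      unfolding infimum_NDT_def
    proof (rule INF_greatest)
      fix p assume "p \<in> {p. valid_policy x r p}"
      \<comment> \<open>The achievable NDT is the supremum of the convex minorants of the scheme, so
        it suffices to bound each of them.\<close>
      then have "achievable_NDT near x r \<le> ereal (3 / 2 * policy_NDT r p)"
        unfolding achievable_NDT_def lower_convex_envelope_def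
        using convex_minorant_le_policy_NDT[OF near r] x by (intro SUP_least) auto
      then have "ereal (2 / 3) * achievable_NDT near x r
          \<le> ereal (2 / 3) * ereal (3 / 2 * policy_NDT r p)"
        by (intro ereal_mult_left_mono) auto
      then show "ereal (2 / 3) * achievable_NDT near x r \<le> ereal (policy_NDT r p)" by simp
    qed
  qed
qed

end

theorem proposition6:
  fixes KT KR nT N :: nat
    and H :: "nat \<Rightarrow> complex mat"
    and near :: "real \<Rightarrow> nat"
    and \<mu> r :: real
  assumes "fran KT KR nT N H"
    and "nearest_positive_rounding near"
    and "0 \<le> \<mu>" and "\<mu> \<le> 1" and "0 \<le> r"
    and "fran.minimum_NDT KT KR nT N H \<mu> r \<noteq> \<infinity>"
  shows "fran.achievable_NDT KT KR nT near \<mu> r / fran.minimum_NDT KT KR nT N H \<mu> r \<le> ereal (3 / 2)"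
proof -
  let ?a = "fran.achievable_NDT KT KR nT near \<mu> r" and ?m = "fran.minimum_NDT KT KR nT N H \<mu> r"
  have a: "1 \<le> ?a" and am: "ereal (2 / 3) * ?a \<le> ?m"
    using fran.achievable_NDT_le_minimum_NDT[OF assms(1,2,5,3,4)] by blast+
  \<comment> \<open>The bounds make \<open>?m\<close> positive, and finiteness of \<open>?m\<close>
    makes \<open>?a\<close> finite, so the quotient is one of positive reals.\<close>
  then show ?thesis
    using assms(6) by (cases ?a; cases ?m) (auto simp: divide_le_eq)
qed

end
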